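(* Let $f,g\in\mathbb{R}[x,y]$ be nonzero polynomials with $f(0,0)=g(0,0)=0$. Assume that $g$ has an isolated zero at the origin and that $F_{f,g}:=\frac{\partial f}{\partial x}\frac{\partial g}{\partial y}-\frac{\partial f}{\partial y}\frac{\partial g}{\partial x}\equiv 0$. Then $$\lim_{(x,y)\to(0,0)}\frac{f(x,y)}{g(x,y)}=0\quad\text{if and only if}\quad \operatorname{ord} f>\operatorname{ord} g.$$
   Context: For a nonzero polynomial $f$, written as a sum of homogeneous components $f=f_m+f_{m+1}+\cdots$ with $f_m\not\equiv 0$ of lowest degree $m$, the order is $\operatorname{ord} f:=m$. "$g$ has an isolated zero at the origin" means $g(0,0)=0$ and $g(x,y)\neq 0$ for all real $(x,y)\ne(0,0)$ in some neighborhood of $(0,0)$ in $\mathbb{R}^2$. The limit is taken over points $(x,y)\in\mathbb{R}^2$ with $g(x,y)\neq 0$. *)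

theory Defs
  imports "HOL-Analysis.Analysis" "HOL-Computational_Algebra.Polynomial"
begin

text \<open>
  The ring \<open>\<real>[x,y]\<close> is rendered as \<open>\<real>[x][y]\<close>: the indeterminate of the outer polynomial is
  \<open>y\<close>, that of the coefficient polynomials is \<open>x\<close>. So \<open>coeff (coeff p j) i\<close> is the coefficient
  of \<open>x\<^sup>i y\<^sup>j\<close>.
\<close>

type_synonym bipoly = "real poly poly"

definition eval2 :: "bipoly \<Rightarrow> real \<times> real \<Rightarrow> real" where
  "eval2 p z = poly (poly p [:snd z:]) (fst z)"

definition partial_x :: "bipoly \<Rightarrow> bipoly" where
  "partial_x p = map_poly pderiv p"

definition partial_y :: "bipoly \<Rightarrow> bipoly" where
  "partial_y p = pderiv p"

definition jacobian2 :: "bipoly \<Rightarrow> bipoly \<Rightarrow> bipoly" where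
  "jacobian2 f g = partial_x f * partial_y g - partial_y f * partial_x g"

definition hom_component :: "nat \<Rightarrow> bipoly \<Rightarrow> bipoly" where
  "hom_component d p = (\<Sum>j\<le>d. monom (monom (coeff (coeff p j) (d - j)) (d - j)) j)"

text \<open>Only meaningful for \<open>p \<noteq> 0\<close>; \<open>ord2 0\<close> is unspecified.\<close>

definition ord2 :: "bipoly \<Rightarrow> nat" where
  "ord2 p = (LEAST m. hom_component m p \<noteq> 0)"

definition isolated_zero_at_origin :: "bipoly \<Rightarrow> bool" where
  "isolated_zero_at_origin g \<longleftrightarrow>
     eval2 g (0, 0) = 0 \<and>
     (\<exists>U. open U \<and> (0, 0) \<in> U \<and> (\<forall>z\<in>U. z \<noteq> (0, 0) \<longrightarrow> eval2 g z \<noteq> 0))"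

lemma eval2_altdef: "eval2 p (x, y) = (\<Sum>j\<le>degree p. poly (coeff p j) x * y ^ j)"
  by (simp add: eval2_def poly_altdef[of p] poly_sum poly_power)

lemma coeff_partial_x:
  "coeff (coeff (partial_x p) j) i = of_nat (Suc i) * coeff (coeff p j) (Suc i)"
  by (simp add: partial_x_def coeff_map_poly coeff_pderiv)

lemma coeff_partial_y:
  "coeff (coeff (partial_y p) j) i = of_nat (Suc j) * coeff (coeff p (Suc j)) i"
  by (simp add: partial_y_def coeff_pderiv of_nat_poly[of "Suc j"] del: of_nat_Suc)

lemma coeff_hom_component:
  "coeff (coeff (hom_component d p) j) i = (if i + j = d then coeff (coeff p j) i else 0)"
  by (auto simp: hom_component_def coeff_sum coeff_monom if_distrib[of "\<lambda>q. coeff q i"] sum.delta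
        cong: if_cong)

lemma ord2_exists:
  assumes "p \<noteq> 0"
  shows "hom_component (ord2 p) p \<noteq> 0"
proof -
  obtain j where "coeff p j \<noteq> 0"
    using assms by (auto simp: poly_eq_iff)
  then obtain i where "coeff (coeff p j) i \<noteq> 0"
    by (auto simp: poly_eq_iff)
  then have "coeff (coeff (hom_component (i + j) p) j) i \<noteq> 0"
    by (simp add: coeff_hom_component)
  then have "hom_component (i + j) p \<noteq> 0"
    by auto
  then show ?thesis
    unfolding ord2_def by (rule LeastI)
qed

end

theory Submission
  imports Defs
begin

text \<open>
  Since the Jacobian vanishes, \<open>f\<close> and \<open>g\<close> are algebraically dependent: \<open>P(f, g) = 0\<close> for some
  nonzero \<open>P\<close>. If \<open>\<beta>\<close> is irrational, the monomials of \<open>P\<close> restricted to \<open>\<bar>u\<bar> = \<bar>w\<bar>\<^sup>\<beta>\<close> have pairwise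
  distinct orders in \<open>w\<close>, so \<open>P(u, w) \<noteq> 0\<close> there for small \<open>w \<noteq> 0\<close>. Hence \<open>\<bar>f\<bar> - \<bar>g\<bar>\<^sup>\<beta>\<close> has no zero, and
  so constant sign, on a small punctured disc, which is connected; the sign is read off on a generic
  ray. If \<open>ord f > ord g\<close>, one can take \<open>1 < \<beta> < ord f / ord g\<close>; the sign is then negative
  and \<open>\<bar>f / g\<bar> < \<bar>g\<bar>\<^bsup>\<beta> - 1\<^esup> \<longlongrightarrow> 0\<close>. The converse only needs the generic ray.
\<close>

section \<open>Algebraic dependence of three bivariate polynomials\<close>

text \<open>Gaussian elimination by induction on the equations: an equation with a nonzero
  coefficient at \<open>p\<close> is solved for the unknown \<open>p\<close>, which leaves one
  equation and one unknown fewer.\<close>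

lemma underdetermined_system:
  fixes a :: "'i \<Rightarrow> 'j \<Rightarrow> 'a::field"
  assumes "finite J" "finite I" "card J < card I"
  shows "\<exists>c. (\<exists>i\<in>I. c i \<noteq> 0) \<and> (\<forall>j\<in>J. (\<Sum>i\<in>I. c i * a i j) = 0)"
  using assms
proof (induction J arbitrary: I a rule: finite_induct)
  case empty
  then obtain i where "i \<in> I"
    by fastforce
  then show ?case
    by (intro exI[of _ "\<lambda>_. 1"]) auto
next
  case (insert k J)
  show ?case
  proof (cases "\<forall>i\<in>I. a i k = 0")
    case True
    have "card J < card I"
      using insert by simp
    from insert.IH[OF insert.prems(1) this, of a]
    obtain c where "\<exists>i\<in>I. c i \<noteq> 0" "\<forall>j\<in>J. (\<Sum>i\<in>I. c i * a i j) = 0"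
      by blast
    with True show ?thesis
      by (intro exI[of _ c]) simp
  next
    case False
    then obtain p where p: "p \<in> I" "a p k \<noteq> 0"
      by auto
    define b where "b i j = a i j - a i k / a p k * a p j" for i j
    have "card J < card (I - {p})"
      using insert p by simp
    from insert.IH[OF _ this, of b] insert.prems(1)
    obtain c where c: "\<exists>i\<in>I - {p}. c i \<noteq> 0" "\<And>j. j \<in> J \<Longrightarrow> (\<Sum>i\<in>I - {p}. c i * b i j) = 0"
      by auto
    \<comment> \<open>Back-substitution: the value at \<open>p\<close> is the one that equation
      \<open>k\<close> forces.\<close>
    define d where "d i = (if i = p then - (\<Sum>i\<in>I - {p}. c i * a i k / a p k) else c i)" for i
    have split: "(\<Sum>i\<in>I. d i * a i j) = (\<Sum>i\<in>I - {p}. c i * b i j)" for j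
    proof -
      have "(\<Sum>i\<in>I. d i * a i j) = d p * a p j + (\<Sum>i\<in>I - {p}. c i * a i j)"
        using p insert.prems(1) by (simp add: sum.remove[of I p] d_def)
      also have "\<dots> = (\<Sum>i\<in>I - {p}. c i * b i j)"
        by (simp add: d_def b_def sum_distrib_right sum_subtractf right_diff_distrib mult.assoc)
      finally show ?thesis .
    qed
    have "b i k = 0" for i
      using p by (simp add: b_def)
    then have "\<forall>j\<in>insert k J. (\<Sum>i\<in>I. d i * a i j) = 0"
      using c(2) by (auto simp: split)
    moreover have "\<exists>i\<in>I. d i \<noteq> 0"
      using c(1) by (auto simp: d_def)
    ultimately show ?thesis
      by blast
  qed
qed

text \<open>Bounding the degree in each variable separately, instead of the total degree, confines
  the coefficients to a square of exponents, which is easy to count.\<close>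

definition bidegree_le :: "nat \<Rightarrow> 'a::comm_ring_1 poly poly \<Rightarrow> bool" where
  "bidegree_le d p \<longleftrightarrow> degree p \<le> d \<and> (\<forall>j. degree (coeff p j) \<le> d)"

lemma bidegree_le_exists: "\<exists>d. bidegree_le d p"
proof -
  have "degree (coeff p j) \<le> Max ((\<lambda>j. degree (coeff p j)) ` {..degree p})" for j
    by (cases "j \<le> degree p") (auto intro!: Max_ge simp: coeff_eq_0)
  then show ?thesis
    by (intro exI[of _ "max (degree p) (Max ((\<lambda>j. degree (coeff p j)) ` {..degree p}))"])
      (auto simp: bidegree_le_def intro: max.coboundedI2)
qed

lemma bidegree_le_mono: "bidegree_le d p \<Longrightarrow> d \<le> e \<Longrightarrow> bidegree_le e p"
  by (auto simp: bidegree_le_def intro: le_trans)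

lemma bidegree_le_mult:
  assumes "bidegree_le d p" "bidegree_le e q"
  shows "bidegree_le (d + e) (p * q)"
proof -
  have "degree (coeff p i * coeff q j) \<le> d + e" for i j
    using degree_mult_le[of "coeff p i" "coeff q j"] assms
    by (meson add_mono bidegree_le_def le_trans)
  then have "degree (coeff (p * q) j) \<le> d + e" for j
    by (auto simp: coeff_mult intro!: degree_sum_le)
  moreover have "degree (p * q) \<le> d + e"
    using degree_mult_le[of p q] assms by (meson add_mono bidegree_le_def le_trans)
  ultimately show ?thesis
    by (simp add: bidegree_le_def)
qed

lemma bidegree_le_power: "bidegree_le d p \<Longrightarrow> bidegree_le (n * d) (p ^ n)"
proof (induction n)
  case 0
  have "degree (coeff (1 :: 'a poly poly) j) = 0" for j
    by (cases j) auto
  then show ?case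
    by (simp add: bidegree_le_def)
next
  case (Suc n)
  then show ?case
    using bidegree_le_mult[of d p "n * d" "p ^ n"] by simp
qed

text \<open>Rational functions in two variables have transcendence degree two. The relation comes
  from a count: the number of monomials is cubic in \<open>N\<close>, while the space containing
  them has dimension only quadratic in \<open>N\<close>.\<close>

lemma three_bipolys_dependent:
  fixes e f g :: "'a::field poly poly"
  obtains N q where "\<exists>a<N. \<exists>b<N. \<exists>c<N. q a b c \<noteq> 0"
    "(\<Sum>a<N. \<Sum>b<N. \<Sum>c<N. smult [:q a b c:] (e ^ a * f ^ b * g ^ c)) = 0"
proof -
  obtain d1 d2 d3 where "bidegree_le d1 e" "bidegree_le d2 f" "bidegree_le d3 g"
    using bidegree_le_exists by metis
  then have "\<exists>d. bidegree_le d e \<and> bidegree_le d f \<and> bidegree_le d g"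
    by (intro exI[of _ "d1 + d2 + d3"]) (auto elim: bidegree_le_mono)
  then obtain d where d: "bidegree_le d e" "bidegree_le d f" "bidegree_le d g"
    by blast
  \<comment> \<open>The \<open>N\<^sup>3\<close> monomials of degree below \<open>N\<close> in each factor lie in a space of dimension
    \<open>(3 d N + 1)\<^sup>2 < N\<^sup>3\<close>.\<close>
  define N where "N = Suc ((3 * d + 1)\<^sup>2)"
  define M where "M = 3 * d * N"
  define I where "I = {..<N} \<times> {..<N} \<times> {..<N}"
  define v where "v = (\<lambda>(a, b, c). e ^ a * f ^ b * g ^ c)"
  have v: "bidegree_le M (v i)" if i_in: "i \<in> I" for i
  proof -
    obtain a b c where i: "i = (a, b, c)" "a < N" "b < N" "c < N"
      using i_in by (cases i) (auto simp: I_def)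
    have "bidegree_le (a * d + b * d + c * d) (v i)"
      unfolding i v_def prod.case using d by (intro bidegree_le_mult bidegree_le_power)
    moreover have "a * d + b * d + c * d \<le> N * d + N * d + N * d"
      using i by (intro add_mono mult_right_mono) auto
    ultimately show ?thesis
      by (rule bidegree_le_mono[OF _ le_trans]) (simp add: M_def)
  qed
  have "M + 1 \<le> (3 * d + 1) * N"
    by (simp add: M_def N_def)
  then have "(M + 1) * (M + 1) \<le> ((3 * d + 1) * N) * ((3 * d + 1) * N)"
    by (intro mult_mono) auto
  also have "\<dots> = (3 * d + 1)\<^sup>2 * (N * N)"
    by (simp only: power2_eq_square mult_ac)
  also have "\<dots> < N * (N * N)"
    by (rule mult_strict_right_mono) (simp_all add: N_def)
  finally have "card ({..M} \<times> {..M}) < card I"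
    by (simp add: I_def card_cartesian_product)
  from underdetermined_system[OF _ _ this, of "\<lambda>i (j, k). coeff (coeff (v i) j) k"]
  obtain c where c: "\<exists>i\<in>I. c i \<noteq> 0"
    and eq: "\<And>j k. j \<le> M \<Longrightarrow> k \<le> M \<Longrightarrow> (\<Sum>i\<in>I. c i * coeff (coeff (v i) j) k) = 0"
    by (auto simp: I_def)
  have "coeff (coeff (\<Sum>i\<in>I. smult [:c i:] (v i)) j) k = 0" for j k
  proof (cases "j \<le> M \<and> k \<le> M")
    case True
    then show ?thesis
      using eq[of j k] by (simp add: coeff_sum)
  next
    case False
    then have "coeff (coeff (v i) j) k = 0" if "i \<in> I" for i
      using v[OF that] unfolding bidegree_le_def
      by (metis coeff_0 coeff_eq_0 le_trans not_le)
    then show ?thesis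
      by (simp add: coeff_sum)
  qed
  then have "(\<Sum>i\<in>I. smult [:c i:] (v i)) = 0"
    by (intro poly_eqI) simp
  then have "(\<Sum>x<N. \<Sum>y<N. \<Sum>z<N. smult [:c (x, y, z):] (e ^ x * f ^ y * g ^ z)) = 0"
    by (simp add: I_def v_def sum.cartesian_product case_prod_unfold)
  moreover have "\<exists>x<N. \<exists>y<N. \<exists>z<N. c (x, y, z) \<noteq> 0"
    using c by (auto simp: I_def)
  ultimately show ?thesis
    using that[of N "\<lambda>x y z. c (x, y, z)"] by blast
qed

section \<open>Derivations and the Jacobian criterion\<close>

locale derivation =
  fixes D :: "'a::{idom,ring_char_0} \<Rightarrow> 'a"
  assumes add: "D (x + y) = D x + D y"
    and mult: "D (x * y) = x * D y + D x * y"
begin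

lemma zero: "D 0 = 0"
  using add[of 0 0] by simp

lemma one: "D 1 = 0"
  using mult[of 1 1] by simp

lemma constant_sum: "(\<And>i. i \<in> A \<Longrightarrow> D (h i) = 0) \<Longrightarrow> D (\<Sum>i\<in>A. h i) = 0"
  by (induction A rule: infinite_finite_induct) (auto simp: zero add)

lemma constant_power: "D x = 0 \<Longrightarrow> D (x ^ n) = 0"
  by (induction n) (auto simp: one mult)

lemma constant_of_nat: "D (of_nat n) = 0"
  by (induction n) (auto simp: zero one add)

lemma chain_rule:
  assumes "\<And>i. D (coeff p i) = 0"
  shows "D (poly p a) = poly (pderiv p) a * D a"
  using assms
proof (induction p)
  case 0
  then show ?case by (simp add: zero)
next
  case (pCons c p)
  have "D c = 0"
    using pCons.prems[of 0] by simp
  moreover have "D (poly p a) = poly (pderiv p) a * D a"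
    using pCons.prems[of "Suc _"] by (intro pCons.IH) simp
  ultimately show ?case
    by (simp add: add mult pderiv_pCons algebra_simps)
qed

text \<open>Applying \<open>D\<close> to \<open>poly p a = 0\<close> gives
  \<open>poly (pderiv p) a * D a = 0\<close>. Unless \<open>D a = 0\<close>, the derivative of
  \<open>p\<close> also has the root \<open>a\<close>; in characteristic zero it is nonzero of
  smaller degree, so the argument descends.\<close>

lemma algebraic_over_constants:
  assumes "p \<noteq> 0" "\<And>i. D (coeff p i) = 0" "poly p a = 0"
  shows "D a = 0"
  using assms
proof (induction "degree p" arbitrary: p rule: less_induct)
  case less
  have "degree p \<noteq> 0"
  proof
    assume "degree p = 0"
    then obtain c where "p = [:c:]"
      by (rule degree_eq_zeroE)
    then show False
      using less.prems by simp
  qed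
  then have smaller: "pderiv p \<noteq> 0" "degree (pderiv p) < degree p"
    by (simp_all add: pderiv_eq_0_iff degree_pderiv)
  have "D (coeff (pderiv p) i) = 0" for i
    by (simp add: coeff_pderiv mult less.prems(2) constant_of_nat del: of_nat_Suc)
  moreover have "poly (pderiv p) a * D a = 0"
    using chain_rule[of p a] less.prems zero by simp
  ultimately show ?case
    using less.hyps[OF smaller(2) smaller(1)] by auto
qed

end

lemma partial_x_add: "partial_x (p + q) = partial_x p + partial_x q"
  by (simp add: partial_x_def poly_eq_iff coeff_map_poly pderiv_add)

lemma partial_x_mult: "partial_x (p * q) = p * partial_x q + partial_x p * q"
proof (rule poly_eqI)
  fix n
  have "coeff (partial_x (p * q)) n = (\<Sum>i\<le>n. pderiv (coeff p i * coeff q (n - i)))"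
    by (simp add: partial_x_def coeff_map_poly coeff_mult higher_pderiv_sum[of 1, simplified])
  also have "\<dots> = coeff (p * partial_x q + partial_x p * q) n"
    by (simp add: partial_x_def coeff_map_poly coeff_mult pderiv_mult sum.distrib
        mult.commute[of "coeff q _"])
  finally show "coeff (partial_x (p * q)) n = coeff (p * partial_x q + partial_x p * q) n" .
qed

text \<open>With \<open>g\<close> fixed, this derivation kills \<open>g\<close>, and also
  \<open>f\<close> once the Jacobian vanishes; hence it kills every real polynomial expression in
  the two.\<close>

lemma derivation_jacobian2: "derivation (\<lambda>h. jacobian2 h g)"
  by unfold_locales
    (simp_all add: jacobian2_def partial_x_add partial_x_mult partial_y_def pderiv_add pderiv_mult
      algebra_simps)

lemma jacobian2_const: "jacobian2 [:[:c:]:] g = 0"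
  by (simp add: jacobian2_def partial_x_def partial_y_def map_poly_pCons pderiv_pCons)

lemma jacobian2_self: "jacobian2 g g = 0"
  by (simp add: jacobian2_def)

text \<open>The two first arguments are the variables x and y, whose Jacobians with \<open>g\<close>
  are, up to sign, the partial derivatives of \<open>g\<close>. So for nonconstant \<open>g\<close>
  some variable is not killed.\<close>

lemma jacobian2_vars_eq_0_imp_const:
  assumes "jacobian2 [:[:0, 1:]:] g = 0" "jacobian2 [:0, 1:] g = 0"
  shows "g = [:[:eval2 g (0, 0):]:]"
proof -
  have "partial_y g = 0" "partial_x g = 0"
    using assms
    by (simp_all add: jacobian2_def partial_x_def partial_y_def map_poly_pCons pderiv_pCons
        flip: one_pCons)
  then have "coeff (coeff g j) (Suc i) = 0" "coeff (coeff g (Suc j)) i = 0" for i j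
    using coeff_partial_x[of g j i] coeff_partial_y[of g j i] by (auto simp del: of_nat_Suc)
  then have "coeff (coeff g j) i = coeff (coeff [:[:eval2 g (0, 0):]:] j) i" for i j
    by (cases i; cases j) (simp_all add: eval2_def poly_0_coeff_0)
  then show ?thesis
    by (intro poly_eqI) blast
qed

text \<open>Trades the differential identity for a polynomial relation, which can be evaluated point
  by point.\<close>

lemma jacobian_criterion:
  assumes "jacobian2 f g = 0" "g \<noteq> [:[:eval2 g (0, 0):]:]"
  obtains N q where "\<exists>b<N. \<exists>c<N. q b c \<noteq> 0"
    "(\<Sum>b<N. \<Sum>c<N. smult [:q b c:] (f ^ b * g ^ c)) = 0"
proof -
  interpret derivation "\<lambda>h. jacobian2 h g"
    by (rule derivation_jacobian2)
  \<comment> \<open>A relation between \<open>e\<close>, \<open>f\<close>, \<open>g\<close>, read as a polynomial in \<open>e\<close>, has coefficients killed by the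
    derivation; as \<open>e\<close> is not killed, all of them vanish.\<close>
  obtain e where e: "jacobian2 e g \<noteq> 0"
    using jacobian2_vars_eq_0_imp_const assms(2) by blast
  obtain N q where q: "\<exists>a<N. \<exists>b<N. \<exists>c<N. q a b c \<noteq> 0"
    and rel: "(\<Sum>a<N. \<Sum>b<N. \<Sum>c<N. smult [:q a b c:] (e ^ a * f ^ b * g ^ c)) = 0"
    by (rule three_bipolys_dependent)
  define r where "r a = (\<Sum>b<N. \<Sum>c<N. smult [:q a b c:] (f ^ b * g ^ c))" for a
  define p where "p = (\<Sum>a<N. monom (r a) a)"
  have coeff_p: "coeff p a = (if a < N then r a else 0)" for a
    by (auto simp: p_def coeff_sum)
  have "jacobian2 (smult [:q a b c:] (f ^ b * g ^ c)) g = 0" for a b c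
  proof -
    have "smult [:q a b c:] (f ^ b * g ^ c) = [:[:q a b c:]:] * (f ^ b * g ^ c)"
      by simp
    then show ?thesis
      by (simp only: mult constant_power assms(1) jacobian2_self jacobian2_const) simp
  qed
  then have "jacobian2 (coeff p a) g = 0" for a
    by (auto simp: coeff_p zero r_def intro!: constant_sum)
  moreover have "poly p e = 0"
    using rel by (simp add: p_def r_def poly_sum poly_monom sum_distrib_left sum_distrib_right mult_ac)
  ultimately have "p = 0"
    using algebraic_over_constants e by blast
  then have "r a = 0" if "a < N" for a
    using coeff_p[of a] that by simp
  with q that show ?thesis
    unfolding r_def by blast
qed

section \<open>Sums of distinct real powers\<close>

text \<open>Distinct exponents give a unique smallest one among the nonzero terms. After dividing by
  that power, every other term tends to 0 and the sum tends to the nonzero coefficient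
  \<open>c k\<close>.\<close>

lemma eventually_sum_powr_nonzero:
  fixes c e :: "'i \<Rightarrow> real"
  assumes "finite I" "inj_on e I" "\<exists>i\<in>I. c i \<noteq> 0"
  shows "eventually (\<lambda>w. (\<Sum>i\<in>I. c i * w powr e i) \<noteq> 0) (at_right 0)"
proof -
  define S where "S = {i\<in>I. c i \<noteq> 0}"
  have S: "finite S" "S \<noteq> {}"
    using assms by (auto simp: S_def)
  define k where "k = arg_min_on e S"
  have k: "k \<in> S" and min: "\<And>i. i \<in> S \<Longrightarrow> e k \<le> e i"
    using arg_min_if_finite[OF S, of e] by (auto simp: k_def not_less)
  have less: "e k < e i" if "i \<in> S - {k}" for i
    using min[of i] that assms(2) k by (auto simp: S_def inj_on_def order.order_iff_strict)
  have "((\<lambda>w. c k + (\<Sum>i\<in>S - {k}. c i * w powr (e i - e k))) \<longlongrightarrow> c k + (\<Sum>i\<in>S - {k}. c i * 0))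
          (at_right 0)"
  proof (intro tendsto_intros)
    fix i assume "i \<in> S - {k}"
    then have "((\<lambda>w. w powr (e i - e k)) \<longlongrightarrow> 0 powr (e i - e k)) (at_right 0)"
      using less by (intro tendsto_powr2 tendsto_intros)
        (auto simp: eventually_at_right_less intro: eventually_mono[OF eventually_at_right_less])
    then show "((\<lambda>w. w powr (e i - e k)) \<longlongrightarrow> 0) (at_right 0)"
      by simp
  qed
  then have "eventually (\<lambda>w. c k + (\<Sum>i\<in>S - {k}. c i * w powr (e i - e k)) \<noteq> 0) (at_right 0)"
    using k by (intro tendsto_imp_eventually_ne) (auto simp: S_def)
  then show ?thesis
    using eventually_at_right_less[of 0]
  proof eventually_elim
    case (elim w)
    have "(\<Sum>i\<in>I. c i * w powr e i) = (\<Sum>i\<in>S. c i * w powr e i)"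
      using assms(1) by (intro sum.mono_neutral_right) (auto simp: S_def)
    also have "\<dots> = c k * w powr e k + (\<Sum>i\<in>S - {k}. c i * w powr e i)"
      using S(1) k by (rule sum.remove)
    also have "\<dots> = w powr e k * (c k + (\<Sum>i\<in>S - {k}. c i * w powr (e i - e k)))"
      using elim by (simp add: distrib_left sum_distrib_left powr_diff)
    finally show ?case
      using elim by simp
  qed
qed

lemma relation_avoids_irrational_power_curve:
  fixes q :: "nat \<Rightarrow> nat \<Rightarrow> real"
  assumes "\<beta> \<notin> \<rat>" "\<exists>b<N. \<exists>c<N. q b c \<noteq> 0"
  obtains \<epsilon> where "\<epsilon> > 0"
    "\<And>u w. w \<noteq> 0 \<Longrightarrow> \<bar>w\<bar> < \<epsilon> \<Longrightarrow> \<bar>u\<bar> = \<bar>w\<bar> powr \<beta> \<Longrightarrow> (\<Sum>b<N. \<Sum>c<N. q b c * (u ^ b * w ^ c)) \<noteq> 0"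
proof -
  define I where "I = {..<N} \<times> {..<N}"
  define ex where "ex = (\<lambda>(b, c). real b * \<beta> + real c)"
  \<comment> \<open>On the curve \<open>u\<close> and \<open>w\<close> are nonzero; \<open>s\<close>
    and \<open>t\<close> stand for their signs, so that only powers of \<open>\<bar>w\<bar>\<close>
    remain.\<close>
  define co where "co s t = (\<lambda>(b, c). q b c * s ^ b * t ^ c)" for s t :: real
  have inj: "inj_on ex I"
  proof (rule inj_onI, clarify)
    fix b c b' c' assume eq: "ex (b, c) = ex (b', c')"
    show "b = b' \<and> c = c'"
    proof (cases "b = b'")
      case True
      then show ?thesis using eq by (simp add: ex_def)
    next
      case False
      \<comment> \<open>A collision of exponents with different \<open>b\<close> would exhibit
        \<beta> as a quotient of integers.\<close>
      then have "\<beta> = (real c' - real c) / (real b - real b')"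
        using eq by (simp add: ex_def field_simps)
      then show ?thesis
        using assms(1) by (metis Rats_diff Rats_divide Rats_of_nat)
    qed
  qed
  have nonzero: "eventually (\<lambda>w. (\<Sum>i\<in>I. co s t i * w powr ex i) \<noteq> 0) (at_right 0)"
    if "s \<in> {1, -1}" "t \<in> {1, -1}" for s t :: real
  proof (rule eventually_sum_powr_nonzero[OF _ inj])
    show "\<exists>i\<in>I. co s t i \<noteq> 0"
      using assms(2) that by (force simp: I_def co_def)
  qed (simp add: I_def)
  \<comment> \<open>The signs may change from point to point, so one \<epsilon> has to serve all
    four sign patterns.\<close>
  have "eventually (\<lambda>w. \<forall>s\<in>{1, -1}. \<forall>t\<in>{1, -1}. (\<Sum>i\<in>I. co s t i * w powr ex i) \<noteq> 0)
      (at_right 0)"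
    by (intro eventually_ball_finite ballI nonzero) simp_all
  then obtain \<epsilon> where \<epsilon>: "\<epsilon> > 0" "\<And>w s t. 0 < w \<Longrightarrow> w < \<epsilon> \<Longrightarrow> s \<in> {1, -1} \<Longrightarrow> t \<in> {1, -1} \<Longrightarrow>
      (\<Sum>i\<in>I. co s t i * w powr ex i) \<noteq> 0"
    unfolding eventually_at_right_field by auto
  show ?thesis
  proof (rule that[OF \<epsilon>(1)])
    fix u w :: real
    assume w: "w \<noteq> 0" "\<bar>w\<bar> < \<epsilon>" and u: "\<bar>u\<bar> = \<bar>w\<bar> powr \<beta>"
    have "q b c * (u ^ b * w ^ c) = co (sgn u) (sgn w) (b, c) * \<bar>w\<bar> powr ex (b, c)" for b c
    proof -
      have "u ^ b = sgn u ^ b * \<bar>w\<bar> powr (real b * \<beta>)"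
      proof -
        have "u ^ b = sgn u ^ b * (\<bar>w\<bar> powr \<beta>) ^ b"
          by (metis u power_mult_distrib sgn_mult_abs)
        also have "(\<bar>w\<bar> powr \<beta>) ^ b = \<bar>w\<bar> powr (real b * \<beta>)"
          using w by (simp add: powr_realpow[symmetric] powr_powr mult.commute)
        finally show ?thesis .
      qed
      moreover have "w ^ c = sgn w ^ c * \<bar>w\<bar> powr real c"
        using w by (simp add: powr_realpow sgn_mult_abs flip: power_mult_distrib)
      ultimately show ?thesis
        by (simp add: co_def ex_def powr_add)
    qed
    then have "(\<Sum>b<N. \<Sum>c<N. q b c * (u ^ b * w ^ c)) =
        (\<Sum>i\<in>I. co (sgn u) (sgn w) i * \<bar>w\<bar> powr ex i)"
      by (simp add: I_def sum.cartesian_product case_prod_unfold)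
    also have "\<dots> \<noteq> 0"
    proof (rule \<epsilon>(2))
      have "u \<noteq> 0"
        using u w by auto
      then show "sgn u \<in> {1, -1}"
        by (simp add: sgn_real_def)
    qed (use w in \<open>auto simp: sgn_real_def\<close>)
    finally show "(\<Sum>b<N. \<Sum>c<N. q b c * (u ^ b * w ^ c)) \<noteq> 0" .
  qed
qed

section \<open>Behaviour on a generic ray\<close>

lemma eval2_mult: "eval2 (p * q) z = eval2 p z * eval2 q z"
  and eval2_smult: "eval2 (smult [:c:] p) z = c * eval2 p z"
  and eval2_0: "eval2 0 z = 0"
  by (simp_all add: eval2_def)

lemma eval2_power: "eval2 (p ^ n) z = eval2 p z ^ n"
  by (simp add: eval2_def poly_power)

lemma eval2_sum: "eval2 (\<Sum>i\<in>A. h i) z = (\<Sum>i\<in>A. eval2 (h i) z)"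
  by (simp add: eval2_def poly_sum)

lemma continuous_on_eval2: "continuous_on S (eval2 p)"
proof -
  have "eval2 p = (\<lambda>z. \<Sum>j\<le>degree p. poly (coeff p j) (fst z) * snd z ^ j)"
    using eval2_altdef[of p] by (auto simp: fun_eq_iff)
  then show ?thesis
    by (auto intro!: continuous_intros)
qed

lemma tendsto_eval2: "(eval2 p \<longlongrightarrow> eval2 p a) (at a)"
  using continuous_on_eval2[of UNIV p] by (cases a) (simp add: continuous_on_eq_continuous_at isCont_def)

text \<open>The dehomogenized lowest form: for \<open>p\<close> of order m with lowest component
  p_m, this is p_m(1, s) as a polynomial in the slope s.\<close>

definition leading_slope_poly :: "bipoly \<Rightarrow> real poly" where
  "leading_slope_poly p = (\<Sum>j\<le>ord2 p. monom (coeff (coeff p j) (ord2 p - j)) j)"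

lemma leading_slope_poly_nonzero:
  assumes "p \<noteq> 0"
  shows "leading_slope_poly p \<noteq> 0"
proof
  assume "leading_slope_poly p = 0"
  then have "coeff (coeff p j) (ord2 p - j) = 0" if "j \<le> ord2 p" for j
    using that by (auto simp: leading_slope_poly_def coeff_sum poly_eq_iff
        split: if_splits dest!: spec[of _ j])
  then have "hom_component (ord2 p) p = 0"
    by (simp add: hom_component_def)
  with ord2_exists[OF assms] show False
    by contradiction
qed

lemma coeff_eq_0_below_ord2:
  assumes "i + j < ord2 p"
  shows "coeff (coeff p j) i = 0"
proof -
  have "hom_component (i + j) p = 0"
    using not_less_Least[of "i + j" "\<lambda>m. hom_component m p \<noteq> 0"] assms by (simp add: ord2_def)
  then show ?thesis
    using coeff_hom_component[of "i + j" p j i] by simp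
qed

text \<open>On the ray of slope \<open>s\<close>, a monomial of total degree k contributes to the
  power t^k alone, so the lowest power is governed by the lowest homogeneous component.\<close>

lemma eval2_ray_tendsto:
  "((\<lambda>t. eval2 p (t, t * s) / t ^ ord2 p) \<longlongrightarrow> poly (leading_slope_poly p) s) (at_right 0)"
proof -
  define m where "m = ord2 p"
  \<comment> \<open>The restriction of \<open>p\<close> to the line y = s x, as a polynomial in x;
    dividing it by x^m gives \<open>h\<close> below, whose value at 0 is the limit.\<close>
  define r where "r = (\<Sum>j\<le>degree p. smult (s ^ j) (monom 1 j * coeff p j))"
  have r_eval: "poly r t = eval2 p (t, t * s)" for t
    by (simp add: r_def eval2_altdef poly_sum poly_monom power_mult_distrib mult_ac)
  have coeff_r: "coeff r k = (\<Sum>j\<le>k. s ^ j * coeff (coeff p j) (k - j))" for k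
  proof -
    have "coeff r k = (\<Sum>j\<le>degree p. if j \<le> k then s ^ j * coeff (coeff p j) (k - j) else 0)"
      by (auto simp: r_def coeff_sum coeff_monom_mult intro!: sum.cong)
    also have "\<dots> = (\<Sum>j\<in>{..degree p} \<inter> {..k}. s ^ j * coeff (coeff p j) (k - j))"
      by (simp add: sum.inter_restrict del: Int_atMost)
    also have "\<dots> = (\<Sum>j\<le>k. s ^ j * coeff (coeff p j) (k - j))"
      by (rule sum.mono_neutral_left) (auto simp: coeff_eq_0)
    finally show ?thesis .
  qed
  have "coeff r k = 0" if "k < m" for k
    using that by (auto simp: coeff_r m_def intro!: sum.neutral coeff_eq_0_below_ord2)
  then have "monom 1 m dvd r"
    by (simp add: monom_1_dvd_iff')
  then obtain h where h: "r = monom 1 m * h"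
    by (elim dvdE)
  have "poly h 0 = coeff r m"
    by (simp add: h coeff_monom_mult poly_0_coeff_0)
  also have "\<dots> = poly (leading_slope_poly p) s"
    by (simp add: coeff_r leading_slope_poly_def m_def poly_sum poly_monom mult.commute)
  finally have h0: "poly h 0 = poly (leading_slope_poly p) s" .
  have "((\<lambda>t. poly h t) \<longlongrightarrow> poly h 0) (at_right 0)"
    by (intro tendsto_intros)
  moreover have "eventually (\<lambda>t. poly h t = eval2 p (t, t * s) / t ^ m) (at_right 0)"
    using eventually_at_right_less[of 0]
    by eventually_elim (simp add: h poly_monom flip: r_eval)
  ultimately show ?thesis
    unfolding h0 m_def by (rule Lim_transform_eventually)
qed

lemma generic_slope_exists:
  assumes "f \<noteq> 0" "g \<noteq> 0"
  obtains s where "poly (leading_slope_poly f) s \<noteq> 0" "poly (leading_slope_poly g) s \<noteq> 0"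
proof -
  have "finite {s. poly (leading_slope_poly f * leading_slope_poly g) s = 0}"
    using assms by (intro poly_roots_finite) (simp add: leading_slope_poly_nonzero)
  then obtain s where "s \<notin> {s. poly (leading_slope_poly f * leading_slope_poly g) s = 0}"
    using infinite_UNIV_char_0 by (metis UNIV_eq_I)
  then show ?thesis
    using that by auto
qed

text \<open>Pulls statements about the plane back to a ray. The predicate \<open>P\<close> carries
  the domain of the quotient, or is constantly true for a full punctured neighborhood.\<close>

lemma ray_filterlim:
  assumes "eventually (\<lambda>t. P (t, t * s)) (at_right 0)"
  shows "filterlim (\<lambda>t. (t, t * s)) (at (0 :: real, 0 :: real) within {z. P z}) (at_right 0)"
  unfolding filterlim_at
proof
  show "eventually (\<lambda>t. (t, t * s) \<in> {z. P z} \<and> (t, t * s) \<noteq> (0, 0)) (at_right 0)"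
    using assms eventually_at_right_less[of 0] by eventually_elim auto
  have "((\<lambda>t. (t, t * s)) \<longlongrightarrow> (0, 0 * s)) (at_right 0)"
    by (intro tendsto_intros)
  then show "((\<lambda>t. (t, t * s)) \<longlongrightarrow> (0, 0)) (at_right 0)"
    by simp
qed

lemma ord2_pos:
  assumes "p \<noteq> 0" "eval2 p (0, 0) = 0"
  shows "ord2 p > 0"
proof (rule ccontr)
  assume "\<not> ord2 p > 0"
  then have "hom_component 0 p \<noteq> 0"
    using ord2_exists[OF assms(1)] by simp
  moreover have "coeff (coeff p 0) 0 = 0"
    using assms(2) by (simp add: eval2_def poly_0_coeff_0)
  ultimately show False
    by (simp add: hom_component_def)
qed

text \<open>If m \<le> n, then on a generic ray f / t^m = (f / g) (g / t^n) t^(n - m) tends to 0,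
  although its limit is the nonzero leading value of \<open>f\<close>.\<close>

lemma quotient_tendsto_0_imp_ord2_less:
  assumes "f \<noteq> 0" "g \<noteq> 0"
    and lim: "((\<lambda>z. eval2 f z / eval2 g z) \<longlongrightarrow> 0) (at (0, 0) within {z. eval2 g z \<noteq> 0})"
  shows "ord2 g < ord2 f"
proof (rule ccontr)
  define m n where "m = ord2 f" and "n = ord2 g"
  assume "\<not> ord2 g < ord2 f"
  then have mn: "m \<le> n"
    by (simp add: m_def n_def)
  obtain s where s: "poly (leading_slope_poly f) s \<noteq> 0" "poly (leading_slope_poly g) s \<noteq> 0"
    using generic_slope_exists assms by blast
  note F = eval2_ray_tendsto[of f s, folded m_def] and G = eval2_ray_tendsto[of g s, folded n_def]
  have ne: "eventually (\<lambda>t. eval2 g (t, t * s) \<noteq> 0) (at_right 0)"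
    using tendsto_imp_eventually_ne[OF G s(2)] by eventually_elim auto
  have "((\<lambda>t. eval2 f (t, t * s) / eval2 g (t, t * s)) \<longlongrightarrow> 0) (at_right 0)"
    by (rule filterlim_compose[OF lim ray_filterlim[OF ne]])
  \<comment> \<open>For m = n this limit is \<open>0 ^ 0 = 1\<close>; the product still tends to 0
    because of its first factor.\<close>
  moreover have "((\<lambda>t. t ^ (n - m)) \<longlongrightarrow> 0 ^ (n - m)) (at_right (0 :: real))"
    by (intro tendsto_intros)
  ultimately have "((\<lambda>t. eval2 f (t, t * s) / eval2 g (t, t * s) *
      (eval2 g (t, t * s) / t ^ n) * t ^ (n - m)) \<longlongrightarrow> 0 * poly (leading_slope_poly g) s * 0 ^ (n - m))
      (at_right 0)"
    by (intro tendsto_mult G)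
  moreover have "eventually (\<lambda>t. eval2 f (t, t * s) / eval2 g (t, t * s) *
      (eval2 g (t, t * s) / t ^ n) * t ^ (n - m) = eval2 f (t, t * s) / t ^ m) (at_right 0)"
    using ne eventually_at_right_less[of 0]
    by eventually_elim (simp add: power_diff mn)
  ultimately have "((\<lambda>t. eval2 f (t, t * s) / t ^ m) \<longlongrightarrow> 0) (at_right 0)"
    by (simp add: Lim_transform_eventually)
  then show False
    using tendsto_unique[OF _ F] s(1) by simp
qed

text \<open>On the ray, |f| / |g|^\<beta> is a convergent factor times t^(m - n \<beta>), and this
  exponent is positive.\<close>

lemma eventually_less_powr_on_ray:
  assumes "poly (leading_slope_poly g) s \<noteq> 0" "real (ord2 g) * \<beta> < real (ord2 f)"
  shows "eventually (\<lambda>t. \<bar>eval2 f (t, t * s)\<bar> < \<bar>eval2 g (t, t * s)\<bar> powr \<beta>) (at_right 0)"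
proof -
  define m n where "m = ord2 f" and "n = ord2 g"
  note F = eval2_ray_tendsto[of f s, folded m_def] and G = eval2_ray_tendsto[of g s, folded n_def]
  have ne: "eventually (\<lambda>t. eval2 g (t, t * s) \<noteq> 0) (at_right 0)"
    using tendsto_imp_eventually_ne[OF G assms(1)] by eventually_elim auto
  have "((\<lambda>t. t powr (m - n * \<beta>)) \<longlongrightarrow> 0 powr (m - n * \<beta>)) (at_right 0)"
    using assms(2) by (intro tendsto_powr2 tendsto_intros)
      (auto simp: m_def n_def intro: eventually_mono[OF eventually_at_right_less])
  then have "((\<lambda>t. \<bar>eval2 f (t, t * s) / t ^ m\<bar> / \<bar>eval2 g (t, t * s) / t ^ n\<bar> powr \<beta> *
      t powr (m - n * \<beta>)) \<longlongrightarrow>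
      \<bar>poly (leading_slope_poly f) s\<bar> / \<bar>poly (leading_slope_poly g) s\<bar> powr \<beta> * 0) (at_right 0)"
    using assms(1) by (intro tendsto_intros F G) auto
  then have "eventually (\<lambda>t. \<bar>eval2 f (t, t * s) / t ^ m\<bar> / \<bar>eval2 g (t, t * s) / t ^ n\<bar> powr \<beta> *
      t powr (m - n * \<beta>) < 1) (at_right 0)"
    by (rule order_tendstoD(2)) simp
  then show ?thesis
    using ne eventually_at_right_less[of 0]
  proof eventually_elim
    case (elim t)
    have "\<bar>eval2 f (t, t * s) / t ^ m\<bar> / \<bar>eval2 g (t, t * s) / t ^ n\<bar> powr \<beta> * t powr (m - n * \<beta>)
        = \<bar>eval2 f (t, t * s)\<bar> / \<bar>eval2 g (t, t * s)\<bar> powr \<beta>"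
      using elim(2,3)
      by (simp add: abs_divide powr_divide powr_diff powr_realpow[symmetric] powr_powr field_simps)
    then show ?case
      using elim by simp
  qed
qed

section \<open>The limit criterion\<close>

lemma irrational_between:
  fixes a b :: real
  assumes "a < b"
  obtains \<beta> where "a < \<beta>" "\<beta> < b" "\<beta> \<notin> \<rat>"
proof -
  have "\<not> {a<..<b} \<subseteq> \<rat>"
    using uncountable_open_interval[of a b] assms countable_rat countable_subset by blast
  then obtain \<beta> where "\<beta> \<in> {a<..<b}" "\<beta> \<notin> \<rat>"
    by blast
  then show ?thesis
    using that[of \<beta>] by simp
qed

lemma tendsto_0_quotientI:
  fixes u v :: "'a \<Rightarrow> real"
  assumes "\<beta> > 1" "(v \<longlongrightarrow> 0) F"
    and "eventually (\<lambda>z. v z \<noteq> 0 \<and> \<bar>u z\<bar> \<le> \<bar>v z\<bar> powr \<beta>) F"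
  shows "((\<lambda>z. u z / v z) \<longlongrightarrow> 0) F"
proof (rule Lim_null_comparison)
  show "eventually (\<lambda>z. norm (u z / v z) \<le> \<bar>v z\<bar> powr (\<beta> - 1)) F"
    using assms(3) by eventually_elim (simp add: powr_diff divide_right_mono)
  have "((\<lambda>z. \<bar>v z\<bar> powr (\<beta> - 1)) \<longlongrightarrow> \<bar>0\<bar> powr (\<beta> - 1)) F"
    using assms(1,2) by (intro tendsto_powr2 tendsto_intros) auto
  then show "((\<lambda>z. \<bar>v z\<bar> powr (\<beta> - 1)) \<longlongrightarrow> 0) F"
    by simp
qed

lemma eventually_bounded_by_powr:
  assumes "f \<noteq> 0" "g \<noteq> 0" "isolated_zero_at_origin g" "jacobian2 f g = 0"
    and "\<beta> \<notin> \<rat>" "real (ord2 g) * \<beta> < real (ord2 f)"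
  shows "eventually (\<lambda>z. eval2 g z \<noteq> 0 \<and> \<bar>eval2 f z\<bar> < \<bar>eval2 g z\<bar> powr \<beta>) (at (0, 0))"
proof -
  have g0: "eval2 g (0, 0) = 0"
    using assms(3) by (simp add: isolated_zero_at_origin_def)
  \<comment> \<open>As \<open>g\<close> vanishes at the origin, being constant would make it 0; so
    the criterion applies.\<close>
  obtain N q where q: "\<exists>b<N. \<exists>c<N. q b c \<noteq> 0"
    and rel: "(\<Sum>b<N. \<Sum>c<N. smult [:q b c:] (f ^ b * g ^ c)) = 0"
    using jacobian_criterion[OF assms(4)] assms(2) g0 by auto
  have rel': "(\<Sum>b<N. \<Sum>c<N. q b c * (eval2 f z ^ b * eval2 g z ^ c)) = 0" for z
    using arg_cong[OF rel, of "\<lambda>p. eval2 p z"]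
    by (simp add: eval2_sum eval2_smult eval2_mult eval2_power eval2_0)
  obtain \<epsilon> where \<epsilon>: "\<epsilon> > 0" and curve: "\<And>u w. w \<noteq> 0 \<Longrightarrow> \<bar>w\<bar> < \<epsilon> \<Longrightarrow> \<bar>u\<bar> = \<bar>w\<bar> powr \<beta> \<Longrightarrow>
      (\<Sum>b<N. \<Sum>c<N. q b c * (u ^ b * w ^ c)) \<noteq> 0"
    using relation_avoids_irrational_power_curve[OF assms(5) q] by blast
  have "eventually (\<lambda>z. \<bar>eval2 g z\<bar> < \<epsilon>) (at (0, 0))"
    using tendstoD[OF tendsto_eval2[of g "(0, 0)"] \<epsilon>] by (simp add: g0)
  moreover have "eventually (\<lambda>z. eval2 g z \<noteq> 0) (at (0, 0))"
    using assms(3) unfolding isolated_zero_at_origin_def eventually_at_topological by blast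
  ultimately have "eventually (\<lambda>z. \<bar>eval2 g z\<bar> < \<epsilon> \<and> eval2 g z \<noteq> 0) (at (0, 0))"
    by eventually_elim simp
  then obtain \<delta> where \<delta>: "\<delta> > 0"
    and near: "\<And>z. z \<noteq> (0, 0) \<Longrightarrow> dist z (0, 0) < \<delta> \<Longrightarrow> \<bar>eval2 g z\<bar> < \<epsilon> \<and> eval2 g z \<noteq> 0"
    unfolding eventually_at by auto
  define B :: "(real \<times> real) set" where "B = ball (0, 0) \<delta> - {(0, 0)}"
  have B: "\<bar>eval2 g z\<bar> < \<epsilon>" "eval2 g z \<noteq> 0" if "z \<in> B" for z
    using near[of z] that by (auto simp: B_def dist_commute)
  define \<phi> where "\<phi> z = \<bar>eval2 f z\<bar> - \<bar>eval2 g z\<bar> powr \<beta>" for z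
  \<comment> \<open>Dimension two enters here: a punctured interval would be disconnected.
    Continuity of \<phi> rests on \<open>g\<close> having no zero in \<open>B\<close>, where the
    real power is continuous.\<close>
  have "connected B"
    unfolding B_def by (rule connected_punctured_ball) simp
  moreover have "continuous_on B \<phi>"
    unfolding \<phi>_def using B by (intro continuous_intros continuous_on_eval2) auto
  ultimately have "connected (\<phi> ` B)"
    by (intro connected_continuous_image)
  \<comment> \<open>A zero of \<phi> would put the values of \<open>f\<close> and \<open>g\<close>
    on the power curve, where the relation between them cannot hold.\<close>
  moreover have "\<phi> z \<noteq> 0" if "z \<in> B" for z
    using curve[of "eval2 g z" "eval2 f z"] rel'[of z] B[OF that] by (auto simp: \<phi>_def)
  moreover have "\<exists>z\<in>B. \<phi> z < 0"
  proof -
    obtain s where "poly (leading_slope_poly g) s \<noteq> 0"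
      using generic_slope_exists assms(1,2) by blast
    then have "eventually (\<lambda>t. \<bar>eval2 f (t, t * s)\<bar> < \<bar>eval2 g (t, t * s)\<bar> powr \<beta>) (at_right 0)"
      using assms(6) by (rule eventually_less_powr_on_ray)
    moreover have "eventually (\<lambda>t. (t, t * s) \<in> B) (at_right 0)"
    proof -
      have "eventually (\<lambda>z. z \<in> B) (at (0, 0))"
        using \<delta> by (auto simp: B_def eventually_at dist_commute intro!: exI[of _ \<delta>])
      then show ?thesis
        using filterlim_iff ray_filterlim[of "\<lambda>_. True" s] by fastforce
    qed
    ultimately have "eventually (\<lambda>t. (t, t * s) \<in> B \<and> \<phi> (t, t * s) < 0) (at_right 0)"
      by eventually_elim (simp add: \<phi>_def)
    then show ?thesis
      using eventually_happens trivial_limit_at_right_real by blast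
  qed
  \<comment> \<open>A connected set of reals that omits 0 and has a negative element is entirely
    negative, so the estimate passes from one ray to all directions.\<close>
  ultimately have neg: "\<phi> z < 0" if "z \<in> B" for z
    using that connectedD_interval[of "\<phi> ` B"]
    by (smt (verit, best) image_iff)
  have "eventually (\<lambda>z. z \<in> B) (at (0, 0))"
    using \<delta> by (auto simp: B_def eventually_at dist_commute intro!: exI[of _ \<delta>])
  then show ?thesis
    by eventually_elim (use neg B in \<open>auto simp: \<phi>_def\<close>)
qed

theorem theorem4p6:
  fixes f g :: bipoly
  assumes "f \<noteq> 0" and "g \<noteq> 0"
    and "eval2 f (0, 0) = 0" and "eval2 g (0, 0) = 0"
    and "isolated_zero_at_origin g"
    and "jacobian2 f g = 0"
  shows "((\<lambda>z. eval2 f z / eval2 g z) \<longlongrightarrow> 0) (at (0, 0) within {z. eval2 g z \<noteq> 0})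
         \<longleftrightarrow> ord2 f > ord2 g"
proof
  assume "((\<lambda>z. eval2 f z / eval2 g z) \<longlongrightarrow> 0) (at (0, 0) within {z. eval2 g z \<noteq> 0})"
  then show "ord2 g < ord2 f"
    using quotient_tendsto_0_imp_ord2_less assms(1,2) by blast
next
  assume less: "ord2 g < ord2 f"
  have pos: "ord2 g > 0"
    using assms by (intro ord2_pos)
  then have "1 < real (ord2 f) / real (ord2 g)"
    using less by simp
  \<comment> \<open>The lower bound makes |g|^(\<beta> - 1) tend to 0, the upper bound gives the
    estimate on a ray, and irrationality keeps the exponents apart.\<close>
  then obtain \<beta> where \<beta>: "1 < \<beta>" "\<beta> < real (ord2 f) / real (ord2 g)" "\<beta> \<notin> \<rat>"
    by (rule irrational_between)
  then have "real (ord2 g) * \<beta> < real (ord2 f)"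
    using pos by (simp add: field_simps)
  from eventually_bounded_by_powr[OF assms(1,2,5,6) \<beta>(3) this]
  have "eventually (\<lambda>z. eval2 g z \<noteq> 0 \<and> \<bar>eval2 f z\<bar> \<le> \<bar>eval2 g z\<bar> powr \<beta>) (at (0, 0))"
    by eventually_elim simp
  moreover have "(eval2 g \<longlongrightarrow> 0) (at (0, 0))"
    using tendsto_eval2[of g "(0, 0)"] assms(4) by simp
  \<comment> \<open>The limit holds over the whole punctured neighborhood, since \<open>g\<close>
    has no zeros there close to the origin; restricting the domain is then immediate.\<close>
  ultimately have "((\<lambda>z. eval2 f z / eval2 g z) \<longlongrightarrow> 0) (at (0, 0))"
    using \<beta>(1) by (intro tendsto_0_quotientI)
  then show "((\<lambda>z. eval2 f z / eval2 g z) \<longlongrightarrow> 0) (at (0, 0) within {z. eval2 g z \<noteq> 0})"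
    by (rule tendsto_within_subset) simp
qed

end
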